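(* Every locally checkable proof for REACHABILITY restricted to graphs of maximum degree at most $2$ (paths and cycles) has, on $n$-node graphs, certificates on $\Omega(\log n)$ bits.
   Context: All graphs are finite, simple, undirected and connected; $N(u)$ is the set of neighbors of $u$ and $d(u)=|N(u)|$. A configuration of $G=(V,E)$ is a map $x\in\{0,1\}^V$. Majority dynamics: from $x^0=x$, for every $t\ge 0$ and all nodes $u$ simultaneously, $x_u^{t+1}=1$ if $\sum_{v\in N(u)}x_v^t>d(u)/2$; $x_u^{t+1}=x_u^t$ if $\sum_{v\in N(u)}x_v^t=d(u)/2$; and $x_u^{t+1}=0$ otherwise. REACHABILITY is the set of instances $(G,(x,y,T))$ where $x,y$ are configurations of $G$, $T>0$ is an integer, and $x^T=y$; each node $v$ has input $(x_v,y_v,T)$ (the same $T$ at all nodes), and the nodes carry distinct identifiers from $\{1,\dots,n^c\}$, with $c>1$ a fixed constant and $n$ the number of nodes. A locally checkable proof for a distributed language $\mathcal L$ restricted to a class of graphs consists of a prover and a verifier. The prover assigns to each node a binary string (certificate), which may depend on the whole instance including identifiers. The verifier has a constant radius $t\ge1$ (depending only on the verifier, not on the instance); each node $v$ sees the subgraph induced by all nodes at distance at most $t$ from $v$, together with their identifiers, inputs and certificates, performs unbounded computation, and accepts or rejects. It must satisfy, for all instances on graphs of the class and all identifier assignments: (completeness) if the instance is in $\mathcal L$, the certificates assigned by the prover make all nodes accept; (soundness) if the instance is not in $\mathcal L$, then for every assignment of certificates at least one node rejects. The certificate size is the function of $n$ giving the maximum number of bits of a certificate assigned by the prover on instances of $\mathcal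 L$ in the class with $n$ nodes. The $\Omega$-bound is on this function as $n\to\infty$. *)

theory Defs
  imports
    Complex_Main
    "HOL-Library.FuncSet"
    "HOL-Library.Extended_Real"
    "Graph_Theory.Graph_Theory"
begin

section \<open>Graphs\<close>

text \<open>
  A finite simple undirected graph is a finite, symmetric, loop-free set of ordered pairs
  (\<^locale>\<open>pair_graph\<close>): every edge is present as two opposite arcs. Connectedness is the graph
  library's notion (which excludes the empty graph), not the topological one of the same name.
\<close>

definition connected_graphs :: "'v pair_pre_digraph set" where
  "connected_graphs = {G. pair_graph G \<and> Digraph_Component.connected (with_proj G)}"

definition neighbors :: "'v pair_pre_digraph \<Rightarrow> 'v \<Rightarrow> 'v set" where
  "neighbors G u = {v. (u, v) \<in> parcs G}"

definition degree :: "'v pair_pre_digraph \<Rightarrow> 'v \<Rightarrow> nat" where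
  "degree G u = card (neighbors G u)"

definition max_degree_le :: "nat \<Rightarrow> 'v pair_pre_digraph set" where
  "max_degree_le k = {G \<in> connected_graphs. \<forall>u \<in> pverts G. degree G u \<le> k}"

definition nodes_within :: "'v pair_pre_digraph \<Rightarrow> nat \<Rightarrow> 'v \<Rightarrow> 'v set" where
  "nodes_within G t v =
     {u \<in> pverts G. \<exists>p. pre_digraph.awalk (with_proj G) v p u \<and> length p \<le> t}"


section \<open>Locally checkable proofs\<close>

text \<open>
  A labelled graph assigns an input to every node. Inputs and identifiers are extensional functions,
  so they carry no information outside the node set.
\<close>

type_synonym ('v, 'i) labelled_graph = "'v pair_pre_digraph \<times> ('v \<Rightarrow> 'i)"

definition identifier_assignments :: "real \<Rightarrow> 'v pair_pre_digraph \<Rightarrow> ('v \<Rightarrow> nat) set" where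
  "identifier_assignments c G =
     {ident \<in> pverts G \<rightarrow>\<^sub>E {i. 1 \<le> i \<and> real i \<le> real (card (pverts G)) powr c}.
        inj_on ident (pverts G)}"

text \<open>
  What a node sees: its own identifier, the induced subgraph on its neighborhood with every node
  replaced by its identifier, and the input and certificate of each identifier in it. Hence a
  verifier has no access to the names of the nodes, nor to the size of the graph.
\<close>

record 'i view =
  center :: nat
  subgraph_seen :: "nat pair_pre_digraph"
  labels_seen :: "nat \<Rightarrow> ('i \<times> bool list) option"

definition view_of ::
  "nat \<Rightarrow> ('v, 'i) labelled_graph \<Rightarrow> ('v \<Rightarrow> nat) \<Rightarrow> ('v \<Rightarrow> bool list) \<Rightarrow> 'v \<Rightarrow> 'i view" where
  "view_of t H ident cert v =
     (let G = fst H; inp = snd H; S = nodes_within G t v in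
      \<lparr> center = ident v,
        subgraph_seen =
          \<lparr> pverts = ident ` S, parcs = map_prod ident ident ` (parcs G \<inter> S \<times> S) \<rparr>,
        labels_seen =
          (\<lambda>i. if i \<in> ident ` S
               then (let u = inv_into S ident i in Some (inp u, cert u))
               else None) \<rparr>)"

type_synonym ('v, 'i) prover = "('v, 'i) labelled_graph \<Rightarrow> ('v \<Rightarrow> nat) \<Rightarrow> 'v \<Rightarrow> bool list"

type_synonym 'i verifier = "'i view \<Rightarrow> bool"

text \<open>
  Here \<open>X\<close> is the set of all admissible instances of the problem, \<open>L\<close> the language (the
  yes-instances among them), \<open>C\<close> the class of graphs and \<open>t\<close> the radius of the verifier.
\<close>

definition locally_checkable_proof ::
  "real \<Rightarrow> ('v, 'i) labelled_graph set \<Rightarrow> ('v, 'i) labelled_graph set \<Rightarrow> 'v pair_pre_digraph set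
   \<Rightarrow> nat \<Rightarrow> ('v, 'i) prover \<Rightarrow> 'i verifier \<Rightarrow> bool" where
  "locally_checkable_proof c X L C t prover verifier \<longleftrightarrow>
     1 \<le> t \<and>
     (\<forall>H \<in> X. fst H \<in> C \<longrightarrow>
        (\<forall>ident \<in> identifier_assignments c (fst H).
           (H \<in> L \<longrightarrow>
              (\<forall>v \<in> pverts (fst H). verifier (view_of t H ident (prover H ident) v))) \<and>
           (H \<notin> L \<longrightarrow>
              (\<forall>cert. \<exists>v \<in> pverts (fst H). \<not> verifier (view_of t H ident cert v)))))"

text \<open>
  The number of instances with \<open>n\<close> nodes need not be finite (inputs may be unbounded), so the
  maximum is a supremum that is possibly infinite.
\<close>

definition certificate_size ::
  "real \<Rightarrow> ('v, 'i) labelled_graph set \<Rightarrow> 'v pair_pre_digraph set \<Rightarrow> ('v, 'i) prover \<Rightarrow> nat \<Rightarrow> enat"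
  where
  "certificate_size c L C prover n =
     (SUP (H, ident, v) \<in> {(H, ident, v).
          H \<in> L \<and> fst H \<in> C \<and> card (pverts (fst H)) = n \<and>
          ident \<in> identifier_assignments c (fst H) \<and> v \<in> pverts (fst H)}.
        enat (length (prover H ident v)))"


section \<open>Majority dynamics and reachability\<close>

definition configurations :: "'v pair_pre_digraph \<Rightarrow> ('v \<Rightarrow> nat) set" where
  "configurations G = (pverts G \<rightarrow>\<^sub>E {0, 1})"

definition majority_step :: "'v pair_pre_digraph \<Rightarrow> ('v \<Rightarrow> nat) \<Rightarrow> 'v \<Rightarrow> nat" where
  "majority_step G x =
     (\<lambda>u \<in> pverts G.
        if real (\<Sum>v \<in> neighbors G u. x v) > real (degree G u) / 2 then 1
        else if real (\<Sum>v \<in> neighbors G u. x v) = real (degree G u) / 2 then x u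
        else 0)"

definition reachability_instance ::
  "'v pair_pre_digraph \<Rightarrow> ('v \<Rightarrow> nat) \<Rightarrow> ('v \<Rightarrow> nat) \<Rightarrow> nat
   \<Rightarrow> ('v, nat \<times> nat \<times> nat) labelled_graph" where
  "reachability_instance G x y T = (G, \<lambda>v \<in> pverts G. (x v, y v, T))"

definition reachability_instances :: "('v, nat \<times> nat \<times> nat) labelled_graph set" where
  "reachability_instances =
     {reachability_instance G x y T | G x y T.
        G \<in> connected_graphs \<and> x \<in> configurations G \<and> y \<in> configurations G \<and> T > 0}"

definition reachability :: "('v, nat \<times> nat \<times> nat) labelled_graph set" where
  "reachability =
     {reachability_instance G x y T | G x y T.
        G \<in> connected_graphs \<and> x \<in> configurations G \<and> y \<in> configurations G \<and> T > 0 \<and>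
        (majority_step G ^^ T) x = y}"

end

theory Submission
  imports Defs "HOL-Real_Asymp.Real_Asymp"
begin

text \<open>
  On a path with \<open>n\<close> nodes, the configuration \<open>1 1 0 1 0 1 \<dots>\<close> moves one node to the right per step,
  with ones entering on the left, so that after \<open>n - 3\<close> steps exactly the last node is \<open>0\<close>, and from
  step \<open>n - 2\<close> on all nodes are \<open>1\<close>. Deleting an even number of consecutive inner nodes while keeping
  \<open>T = n - 3\<close> thus turns a yes-instance into a no-instance that looks the same locally. To hide the
  cut, a window of \<open>2t\<close> nodes, placed at position \<open>i\<close>, carries identifiers \<open>1, \<dots>, 2t\<close>, and
  disjoint ranges of identifiers are used on its two sides. With certificates of fewer than
  \<open>log n / (4t)\<close> bits, two of the linearly many window positions of equal parity carry the same
  certificates; joining the left part of one instance to the right part of the other along the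
  window yields a no-instance in which every view occurs in a yes-instance.
\<close>

section \<open>Views\<close>

text \<open>A view names nodes only by their identifiers, so an isomorphism \<open>f\<close> of two
  balls that respects identifiers, inputs and certificates leaves it unchanged. Injectivity of the
  identifiers makes \<open>inv_into\<close> pick corresponding nodes.\<close>

lemma view_of_eqI:
  assumes "bij_betw f (nodes_within (fst H) t v) (nodes_within (fst H') t (f v))"
    and "v \<in> nodes_within (fst H) t v"
    and inj: "inj_on ident (nodes_within (fst H) t v)"
    and inj': "inj_on ident' (nodes_within (fst H') t (f v))"
    and arcs: "\<And>a b. a \<in> nodes_within (fst H) t v \<Longrightarrow> b \<in> nodes_within (fst H) t v \<Longrightarrow>
      (f a, f b) \<in> parcs (fst H') \<longleftrightarrow> (a, b) \<in> parcs (fst H)"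
    and lab: "\<And>a. a \<in> nodes_within (fst H) t v \<Longrightarrow>
      ident' (f a) = ident a \<and> snd H' (f a) = snd H a \<and> cert' (f a) = cert a"
  shows "view_of t H' ident' cert' (f v) = view_of t H ident cert v"
proof -
  define S where "S = nodes_within (fst H) t v"
  define S' where "S' = nodes_within (fst H') t (f v)"
  have S': "S' = f ` S"
    using assms(1) unfolding S_def S'_def bij_betw_def by auto
  have lab: "ident' (f a) = ident a" "snd H' (f a) = snd H a" "cert' (f a) = cert a"
    if "a \<in> S" for a
    using lab that unfolding S_def by auto
  have im: "ident' ` S' = ident ` S"
    unfolding S' using lab by force
  have "map_prod ident' ident' ` (parcs (fst H') \<inter> S' \<times> S')
      = map_prod ident ident ` (parcs (fst H) \<inter> S \<times> S)" (is "?A = ?B")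
  proof (intro equalityI subsetI)
    fix e assume "e \<in> ?A"
    then obtain a b where "a \<in> S" "b \<in> S" "(f a, f b) \<in> parcs (fst H')" "e = (ident' (f a), ident' (f b))"
      unfolding S' by auto
    with lab arcs have "(a, b) \<in> parcs (fst H) \<inter> S \<times> S" "e = map_prod ident ident (a, b)"
      unfolding S_def by auto
    then show "e \<in> ?B"
      by (metis image_eqI)
  next
    fix e assume "e \<in> ?B"
    then obtain a b where "a \<in> S" "b \<in> S" "(a, b) \<in> parcs (fst H)" "e = (ident a, ident b)"
      by auto
    with lab arcs have "(f a, f b) \<in> parcs (fst H') \<inter> S' \<times> S'" "e = map_prod ident' ident' (f a, f b)"
      unfolding S_def S' by auto
    then show "e \<in> ?A"
      by (metis image_eqI)
  qed
  moreover have "(snd H' (inv_into S' ident' i), cert' (inv_into S' ident' i))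
      = (snd H (inv_into S ident i), cert (inv_into S ident i))"
    if "i \<in> ident ` S" for i
  proof -
    obtain a where a: "a \<in> S" "i = ident a"
      using \<open>i \<in> ident ` S\<close> by auto
    then have "inv_into S ident i = a"
      using inj S_def by simp
    moreover have "inv_into S' ident' i = f a"
      using a lab inj' S' unfolding S'_def[symmetric] by (metis imageI inv_into_f_f)
    ultimately show ?thesis
      using a lab by simp
  qed
  ultimately show ?thesis
    using im lab assms(2) unfolding view_of_def Let_def S_def[symmetric] S'_def[symmetric]
    by (auto simp: fun_eq_iff)
qed

section \<open>Paths\<close>

definition path_graph :: "nat \<Rightarrow> nat pair_pre_digraph" where
  "path_graph n =
     \<lparr> pverts = {..<n}, parcs = {(u, v). u < n \<and> v < n \<and> (v = Suc u \<or> u = Suc v)} \<rparr>"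

lemma pverts_path_graph [simp]: "pverts (path_graph n) = {..<n}"
  and parcs_path_graph [simp]:
    "(u, v) \<in> parcs (path_graph n) \<longleftrightarrow> u < n \<and> v < n \<and> (v = Suc u \<or> u = Suc v)"
  by (auto simp: path_graph_def)

lemma pair_graph_path_graph: "pair_graph (path_graph n)"
proof
  have "parcs (path_graph n) \<subseteq> {..<n} \<times> {..<n}"
    by auto
  then show "finite (parcs (path_graph n))"
    by (rule finite_subset) simp
qed (auto simp: path_graph_def symmetric_def sym_def)

lemma neighbors_path_graph:
  "u < n \<Longrightarrow> neighbors (path_graph n) u
     = (if u = 0 then {} else {u - 1}) \<union> (if Suc u < n then {Suc u} else {})"
  by (auto simp: neighbors_def)

text \<open>Each arc changes the node number by one. Writing the bounds as sums avoids truncated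
  subtraction.\<close>

lemma awalk_path_graph_dist:
  assumes "pre_digraph.awalk (with_proj (path_graph n)) u p v"
  shows "u \<le> v + length p \<and> v \<le> u + length p"
  using assms
proof (induction p arbitrary: u)
  case Nil
  then show ?case by (simp add: pre_digraph.awalk_def pre_digraph.cas.simps)
next
  case (Cons e p)
  interpret pair_graph "path_graph n" by (rule pair_graph_path_graph)
  obtain a b where "e = (a, b)"
    by fastforce
  with Cons.prems have "u = a" "(a, b) \<in> parcs (path_graph n)" "awalk b p v"
    by (auto simp: awalk_Cons_iff)
  with Cons.IH[of b] show ?case
    by auto
qed

text \<open>Induction on the length budget \<open>k\<close>, not on the distance: each arc goes one
  node towards \<open>v\<close>, and the walk stops on arrival even if budget is left.\<close>

lemma awalk_path_graph_exists:
  assumes "u < n" "v < n" "u \<le> v + k" "v \<le> u + k"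
  shows "\<exists>p. pre_digraph.awalk (with_proj (path_graph n)) u p v \<and> length p \<le> k"
  using assms
proof (induction k arbitrary: u)
  interpret pair_graph "path_graph n" by (rule pair_graph_path_graph)
  {
    case 0
    then have "awalk u [] v"
      by (simp add: awalk_Nil_iff)
    then show ?case by auto
  next
    case (Suc k)
    consider "u = v" | "u < v" | "v < u" by linarith
    then show ?case
    proof cases
      case 1
      then have "awalk u [] v"
        using Suc.prems by (simp add: awalk_Nil_iff)
      then show ?thesis by fastforce
    next
      case 2
      then obtain p where "awalk (Suc u) p v" "length p \<le> k"
        using Suc.IH[of "Suc u"] Suc.prems by auto
      then have "awalk u ((u, Suc u) # p) v" "length ((u, Suc u) # p) \<le> Suc k"
        using 2 Suc.prems by (auto simp: awalk_Cons_iff)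
      then show ?thesis by blast
    next
      case 3
      then have "u - 1 < n" "u - 1 \<le> v + k" "v \<le> u - 1 + k"
        using Suc.prems by linarith+
      then obtain p where "awalk (u - 1) p v" "length p \<le> k"
        using Suc.IH[of "u - 1"] Suc.prems(2) by blast
      then have "awalk u ((u, u - 1) # p) v" "length ((u, u - 1) # p) \<le> Suc k"
        using 3 Suc.prems by (auto simp: awalk_Cons_iff)
      then show ?thesis by blast
    qed
  }
qed

lemma nodes_within_path_graph:
  assumes "v < n"
  shows "nodes_within (path_graph n) t v = {u. u < n \<and> u \<le> v + t \<and> v \<le> u + t}"
proof (intro equalityI subsetI)
  fix u assume "u \<in> nodes_within (path_graph n) t v"
  then show "u \<in> {u. u < n \<and> u \<le> v + t \<and> v \<le> u + t}"
    using awalk_path_graph_dist unfolding nodes_within_def by fastforce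
next
  fix u assume "u \<in> {u. u < n \<and> u \<le> v + t \<and> v \<le> u + t}"
  then show "u \<in> nodes_within (path_graph n) t v"
    using awalk_path_graph_exists[of v n u t] assms unfolding nodes_within_def by auto
qed

lemma path_graph_connected:
  assumes "n > 0"
  shows "path_graph n \<in> connected_graphs"
proof -
  interpret pair_graph "path_graph n" by (rule pair_graph_path_graph)
  have "u \<rightarrow>\<^sup>*\<^bsub>mk_symmetric (path_graph n)\<^esub> v" if "u < n" "v < n" for u v
    using awalk_path_graph_exists[of u n v n] that
    by (auto intro!: reachable_mk_symmetricI simp: reachable_awalk)
  then have "Digraph_Component.connected (path_graph n)"
    using assms by (auto simp: Digraph_Component.connected_def strongly_connected_def)
  then show ?thesis
    by (simp add: connected_graphs_def pair_graph_path_graph)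
qed

lemma path_graph_max_degree:
  assumes "n > 0"
  shows "path_graph n \<in> max_degree_le 2"
  using path_graph_connected[OF assms]
  by (auto simp: max_degree_le_def degree_def neighbors_path_graph)

section \<open>Majority dynamics on a path\<close>

text \<open>State at time \<open>s\<close> of the process started in 1 1 0 1 0 1 ...: ones up to
  node \<open>s + 1\<close>, a zero at \<open>s + 2\<close>, alternating from there on.\<close>

definition wave :: "nat \<Rightarrow> nat \<Rightarrow> nat \<Rightarrow> nat" where
  "wave n s = (\<lambda>k\<in>{..<n}. if k \<le> s \<or> odd (k - s) then 1 else 0)"

lemma wave_in_configurations: "wave n s \<in> configurations (path_graph n)"
  by (auto simp: configurations_def wave_def)

text \<open>The two ends copy their only neighbor, which exists as \<open>n \<ge> 2\<close>. Inner
  nodes are settled by their position relative to the front \<open>s\<close>.\<close>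

lemma majority_step_wave:
  assumes "n \<ge> 2"
  shows "majority_step (path_graph n) (wave n s) = wave n (Suc s)"
proof
  fix u
  show "majority_step (path_graph n) (wave n s) u = wave n (Suc s) u"
  proof (cases "u < n")
    case False
    then show ?thesis by (simp add: majority_step_def wave_def)
  next
    case u: True
    consider "u = 0" | "u > 0" "Suc u = n" | "u > 0" "Suc u < n"
      using u by linarith
    then show ?thesis
    proof cases
      case 1
      then show ?thesis
        using assms u
        by (cases "s = 0") (auto simp: majority_step_def degree_def neighbors_path_graph wave_def)
    next
      case 2
      then show ?thesis
        using u
        by (cases "u \<le> s") (auto simp: majority_step_def degree_def neighbors_path_graph wave_def)
    next
      case 3
      then obtain w where w: "u = Suc w"
        by (cases u) auto
      have nb: "neighbors (path_graph n) u = {w, Suc u}"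
        using 3 w by (auto simp: neighbors_path_graph)
      have "(\<Sum>v\<in>neighbors (path_graph n) u. wave n s v) = wave n s w + wave n s (Suc u)"
        using w unfolding nb by simp
      moreover have "degree (path_graph n) u = 2"
        using w unfolding degree_def nb by simp
      ultimately have step: "majority_step (path_graph n) (wave n s) u
          = (if wave n s w + wave n s (Suc u) > 1 then 1
             else if wave n s w + wave n s (Suc u) = 1 then wave n s u else 0)"
        using u by (simp add: majority_step_def del: of_nat_sum)
      have "\<exists>d. u = Suc (Suc (s + d))" if "Suc s < u"
        using less_imp_Suc_add[OF that] by simp
      \<comment> \<open>Up to \<open>s\<close> both neighbors are 1. At \<open>Suc s\<close> the
        neighbors are 1 and 0, and the tie keeps the value 1. Further right both neighbors carry the
        opposite value, so the node flips.\<close>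
      then consider "u \<le> s" | "u = Suc s" | d where "u = Suc (Suc (s + d))"
        by fastforce
      then show ?thesis
        unfolding step using 3 w by cases (auto simp: wave_def)
    qed
  qed
qed

lemma majority_iterate_wave:
  assumes "n \<ge> 2"
  shows "(majority_step (path_graph n) ^^ T) (wave n 0) = wave n T"
  by (induction T) (simp_all add: majority_step_wave[OF assms])

text \<open>The target is constant except at the right end, so removing inner nodes leaves no local
  trace in it.\<close>

definition last_zero :: "nat \<Rightarrow> nat \<Rightarrow> nat" where
  "last_zero n = (\<lambda>k\<in>{..<n}. if Suc k = n then 0 else 1)"

lemma last_zero_in_configurations: "last_zero n \<in> configurations (path_graph n)"
  by (auto simp: configurations_def last_zero_def)

lemma wave_eq_last_zero: "wave (m + 3) m = last_zero (m + 3)"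
proof
  fix k
  consider "k \<le> m" | "k = m + 1" | "k = m + 2" | "k \<ge> m + 3"
    by linarith
  then show "wave (m + 3) m k = last_zero (m + 3) k"
    by cases (auto simp: wave_def last_zero_def)
qed

text \<open>The last node \<open>m + 2\<close> is 1 from time \<open>m + 1\<close> on: first by
  parity, later because it lies behind the front.\<close>

lemma wave_neq_last_zero:
  assumes "T \<ge> m + 1"
  shows "wave (m + 3) T \<noteq> last_zero (m + 3)"
proof -
  consider "T \<ge> m + 2" | "T = m + 1"
    using assms by linarith
  then have "wave (m + 3) T (m + 2) = 1"
    by cases (auto simp: wave_def)
  moreover have "last_zero (m + 3) (m + 2) = 0"
    by (simp add: last_zero_def)
  ultimately show ?thesis by auto
qed

section \<open>Yes- and no-instances built from the wave\<close>

definition wave_instance :: "nat \<Rightarrow> nat \<Rightarrow> (nat, nat \<times> nat \<times> nat) labelled_graph" where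
  "wave_instance n T = reachability_instance (path_graph n) (wave n 0) (last_zero n) T"

lemma fst_wave_instance [simp]: "fst (wave_instance n T) = path_graph n"
  by (simp add: wave_instance_def reachability_instance_def)

text \<open>The input depends only on parity, on being an end, and on \<open>T\<close>; shifting
  nodes by an even amount, right end onto right end, therefore preserves inputs away from node
  0.\<close>

lemma snd_wave_instance:
  "k < n \<Longrightarrow> snd (wave_instance n T) k
     = (if k = 0 \<or> odd k then 1 else 0, if Suc k = n then 0 else 1, T)"
  by (simp add: wave_instance_def reachability_instance_def wave_def last_zero_def)

lemma wave_instance_admissible:
  "n > 0 \<Longrightarrow> T > 0 \<Longrightarrow> wave_instance n T \<in> reachability_instances"
  unfolding reachability_instances_def wave_instance_def
  using path_graph_connected wave_in_configurations last_zero_in_configurations by blast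

lemma wave_instance_reachable:
  assumes "m > 0"
  shows "wave_instance (m + 3) m \<in> reachability"
proof -
  have "(majority_step (path_graph (m + 3)) ^^ m) (wave (m + 3) 0) = last_zero (m + 3)"
    by (simp add: majority_iterate_wave wave_eq_last_zero)
  then show ?thesis
    unfolding reachability_def wave_instance_def
    using assms
    by (intro CollectI exI[of _ "path_graph (m + 3)"] exI[of _ "wave (m + 3) 0"]
        exI[of _ "last_zero (m + 3)"] exI[of _ m])
      (simp add: path_graph_connected wave_in_configurations last_zero_in_configurations)
qed

text \<open>Membership in \<open>reachability\<close> is existential over representations, so
  refuting it needs unique data. Extensionality fixes the configurations off the graph; a single
  node suffices to read off \<open>T\<close>.\<close>

lemma reachability_instance_inject:
  assumes "reachability_instance G x y T = reachability_instance G' x' y' T'"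
    and "x \<in> configurations G" "y \<in> configurations G"
    and "x' \<in> configurations G'" "y' \<in> configurations G'" "pverts G \<noteq> {}"
  shows "G' = G \<and> x' = x \<and> y' = y \<and> T' = T"
proof -
  have G: "G' = G"
    and eq: "\<And>v. v \<in> pverts G \<Longrightarrow> (x v, y v, T) = (x' v, y' v, T')"
    using assms(1) by (auto simp: reachability_instance_def dest!: fun_cong split: if_splits)
  have "x' v = x v \<and> y' v = y v" for v
  proof (cases "v \<in> pverts G")
    case True
    with eq[of v] show ?thesis by simp
  next
    case False
    with assms(2-5)[unfolded configurations_def G] show ?thesis
      by (metis PiE_arb)
  qed
  then have "x' = x" "y' = y"
    by auto
  with G eq assms(6) show ?thesis by auto
qed

lemma wave_instance_unreachable:
  assumes "T \<ge> m + 1"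
  shows "wave_instance (m + 3) T \<notin> reachability"
proof
  assume "wave_instance (m + 3) T \<in> reachability"
  then obtain G x y T' where *: "wave_instance (m + 3) T = reachability_instance G x y T'"
    "x \<in> configurations G" "y \<in> configurations G" "(majority_step G ^^ T') x = y"
    unfolding reachability_def by blast
  have "pverts (path_graph (m + 3)) \<noteq> {}"
    by (auto simp: lessThan_empty_iff)
  with * have "G = path_graph (m + 3) \<and> x = wave (m + 3) 0 \<and> y = last_zero (m + 3) \<and> T' = T"
    unfolding wave_instance_def
    by (intro reachability_instance_inject wave_in_configurations last_zero_in_configurations)
  with *(4) have "wave (m + 3) T = last_zero (m + 3)"
    by (simp add: majority_iterate_wave)
  with wave_neq_last_zero[OF assms] show False by simp
qed

section \<open>Gluing\<close>

text \<open>
  The window \<open>[i, i + w)\<close> carries the same identifiers whatever \<open>i\<close> is, and identifiers to the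
  left of a window never occur to the right of another one.
\<close>

definition window_ident :: "nat \<Rightarrow> nat \<Rightarrow> nat \<Rightarrow> nat \<Rightarrow> nat" where
  "window_ident n w i = (\<lambda>k\<in>{..<n}.
     if k < i then w + 1 + k else if k < i + w then k - i + 1 else w + n + 1 + k)"

text \<open>Window, left part and right part use the disjoint ranges \<open>[1, w]\<close>,
  \<open>[w + 1, w + n]\<close> and \<open>[w + n + 1, w + 2 * n]\<close>.\<close>

lemma window_ident_assignment:
  assumes "real (w + 2 * n) \<le> real n powr c"
  shows "window_ident n w i \<in> identifier_assignments c (path_graph n)"
proof -
  have "1 \<le> window_ident n w i k \<and> real (window_ident n w i k) \<le> real n powr c" if "k < n" for k
  proof -
    have "1 \<le> window_ident n w i k" "window_ident n w i k \<le> w + 2 * n"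
      using that by (auto simp: window_ident_def)
    with assms show ?thesis
      by (meson of_nat_mono order_trans)
  qed
  moreover have "inj_on (window_ident n w i) {..<n}"
    by (rule inj_onI) (auto simp: window_ident_def split: if_splits)
  moreover have "window_ident n w i \<in> extensional {..<n}"
    by (simp add: window_ident_def)
  ultimately show ?thesis
    by (auto simp: identifier_assignments_def PiE_iff)
qed

text \<open>Cut and paste of labellings: the gap of \<open>d\<close> nodes starting at
  \<open>m\<close> is skipped, and \<open>n\<close> is the length of the resulting path.\<close>

definition glue :: "nat \<Rightarrow> nat \<Rightarrow> nat \<Rightarrow> (nat \<Rightarrow> 'a) \<Rightarrow> (nat \<Rightarrow> 'a) \<Rightarrow> nat \<Rightarrow> 'a" where
  "glue n m d f g = (\<lambda>k\<in>{..<n}. if k < m then f k else g (k + d))"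

text \<open>The three ranges stay disjoint because the right part keeps its old identifiers; the
  largest may still be near \<open>w + 2 * n\<close>, which must now be allowed on only
  \<open>n - d\<close> nodes.\<close>

lemma glue_window_ident_assignment:
  assumes "real (w + 2 * n) \<le> real (n - d) powr c" "j = i + d"
  shows "glue (n - d) (i + w) d (window_ident n w i) (window_ident n w j)
    \<in> identifier_assignments c (path_graph (n - d))" (is "?g \<in> _")
proof -
  have g: "?g k = (if k < i then w + 1 + k else if k < i + w then k - i + 1 else w + n + 1 + k + d)"
    if "k < n - d" for k
    using that assms(2) by (auto simp: glue_def window_ident_def)
  have "1 \<le> ?g k \<and> real (?g k) \<le> real (n - d) powr c" if "k < n - d" for k
  proof -
    have "1 \<le> ?g k" "?g k \<le> w + 2 * n"
      using that by (auto simp: g)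
    with assms(1) show ?thesis
      by (meson of_nat_mono order_trans)
  qed
  moreover have "inj_on ?g {..<n - d}"
    by (rule inj_onI) (auto simp: g split: if_splits)
  moreover have "?g \<in> extensional {..<n - d}"
    by (simp add: glue_def)
  ultimately show ?thesis
    by (auto simp: identifier_assignments_def PiE_iff)
qed

text \<open>A ball of radius \<open>t\<close> cannot stick out of a window of width
  \<open>2 * t\<close> on both sides of its middle. So each view in the glued instance already
  occurs in the yes-instance with the window at \<open>i\<close> or at \<open>j\<close>, and the
  verifier accepts everywhere.\<close>

lemma repeated_window_certs_contradiction:
  fixes prover :: "(nat, nat \<times> nat \<times> nat) prover"
  assumes lcp: "locally_checkable_proof c reachability_instances reachability (max_degree_le 2)
                  t prover verifier"
    and w: "w = 2 * t"
    and j: "j = i + d" "even d" "d > 0" "i > 0" "j + w < m + 3"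
    and ids: "real (w + 2 * (m + 3)) \<le> real (m + 3 - d) powr c"
    and "c > 0"
    and same: "\<And>q. q < w \<Longrightarrow>
      prover (wave_instance (m + 3) m) (window_ident (m + 3) w i) (i + q)
      = prover (wave_instance (m + 3) m) (window_ident (m + 3) w j) (j + q)"
  shows False
proof -
  have t: "t \<ge> 1"
    using lcp by (simp add: locally_checkable_proof_def)
  have m: "d < m" "m > 0"
    using j w t by auto
  define n where "n = m + 3"
  define n' where "n' = m + 3 - d"
  define H where "H = wave_instance n m"
  define H' where "H' = wave_instance n' m"
  define g where "g = glue n' (i + w) d (window_ident n w i) (window_ident n w j)"
  define cert where "cert = glue n' (i + w) d (prover H (window_ident n w i)) (prover H (window_ident n w j))"
  have n': "n' = n - d" "n' = (m - d) + 3"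
    using m by (auto simp: n_def n'_def)
  have ids': "real (w + 2 * n) \<le> real n powr c"
  proof -
    have "real n' powr c \<le> real n powr c"
      using \<open>c > 0\<close> n' by (intro powr_mono2) auto
    with ids show ?thesis
      unfolding n_def n'_def by linarith
  qed
  note win = window_ident_assignment[OF ids']
  have accept: "verifier (view_of t H (window_ident n w k) (prover H (window_ident n w k)) v)"
    if "v < n" for k v
  proof -
    have "H \<in> reachability" "H \<in> reachability_instances" "fst H \<in> max_degree_le 2"
      using wave_instance_reachable[OF m(2)] wave_instance_admissible[of n m] m
        path_graph_max_degree[of n] by (auto simp: H_def n_def)
    with lcp win[of k] that show ?thesis
      unfolding locally_checkable_proof_def H_def by fastforce
  qed
  have g: "g \<in> identifier_assignments c (path_graph n')"
    unfolding g_def n'(1) by (rule glue_window_ident_assignment)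
      (use ids j n' in \<open>simp_all add: n_def\<close>)
  \<comment> \<open>The time is still \<open>m\<close>, whereas a path of \<open>n'\<close> nodes
    passes through the target only at time \<open>m - d\<close>.\<close>
  have "H' \<notin> reachability"
    unfolding H'_def n'(2) by (rule wave_instance_unreachable) (use m j in auto)
  moreover have "H' \<in> reachability_instances" "fst H' \<in> max_degree_le 2"
    using wave_instance_admissible[of n' m] path_graph_max_degree[of n'] m n'
    by (auto simp: H'_def)
  ultimately obtain v where v: "v < n'" "\<not> verifier (view_of t H' g cert v)"
    using lcp g unfolding locally_checkable_proof_def H'_def by fastforce
  have inj: "inj_on g {..<n'}" "inj_on (window_ident n w k) {..<n}" for k
    using g win by (auto simp: identifier_assignments_def)
  have nd: "n = n' + d" and bound: "i + w < n'" "w = t + t" "i > 0" "d > 0"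
    using m j w by (auto simp: n_def n'_def)
  have less: "u < n' \<Longrightarrow> u < n" "u + d < n \<longleftrightarrow> u < n'" for u
    by (auto simp: nd)
  have "nodes_within (path_graph k) t u \<subseteq> {..<k}" for k u
    by (auto simp: nodes_within_def)
  then have inj_ball: "inj_on g (nodes_within (path_graph n') t u)"
    "inj_on (window_ident n w k) (nodes_within (path_graph n) t u)" for u k
    using inj inj_on_subset by blast+
  show False
  \<comment> \<open>The split is at the middle of the window: balls of nodes before it end before
    \<open>i + w\<close>, balls of the others start at \<open>i\<close> or later.\<close>
  proof (cases "v < i + t")
    case True
    have S: "nodes_within (path_graph n') t v = {u. u < n' \<and> u \<le> v + t \<and> v \<le> u + t}"
      "nodes_within (path_graph n) t v = {u. u < n' \<and> u \<le> v + t \<and> v \<le> u + t}"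
      using v(1) bound nd True by (auto simp: nodes_within_path_graph)
    have "view_of t H (window_ident n w i) (prover H (window_ident n w i)) (id v)
        = view_of t H' g cert v"
    proof (rule view_of_eqI)
      show "inj_on g (nodes_within (fst H') t v)"
        "inj_on (window_ident n w i) (nodes_within (fst H) t (id v))"
        by (simp_all add: H_def H'_def inj_ball)
    next
      fix a assume "a \<in> nodes_within (fst H') t v"
      \<comment> \<open>The ball contains the right end of neither path, so the target value is 1 in
        both.\<close>
      then have "a < n'" "a < i + w" "Suc a \<noteq> n'" "Suc a \<noteq> n" "a < n"
        using True bound nd by (auto simp: H'_def S)
      then show "window_ident n w i (id a) = g a \<and> snd H (id a) = snd H' a \<and>
          prover H (window_ident n w i) (id a) = cert a"
        by (simp add: g_def cert_def glue_def H_def H'_def snd_wave_instance)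
    qed (use v(1) less in \<open>auto simp: H_def H'_def S bij_betw_def\<close>)
    with accept[of v i] v less show False
      by simp
  next
    case False
    \<comment> \<open>Here the ball lies to the right of node 0, so the shift by \<open>d\<close>
      loses nothing on the left, and the right ends of the two paths correspond.\<close>
    have S: "nodes_within (path_graph n') t v = {u. u < n' \<and> u \<le> v + t \<and> v \<le> u + t}"
      "nodes_within (path_graph n) t (v + d)
         = (\<lambda>u. u + d) ` {u. u < n' \<and> u \<le> v + t \<and> v \<le> u + t}"
    proof -
      have "u \<in> (\<lambda>u. u + d) ` {u. u < n' \<and> u \<le> v + t \<and> v \<le> u + t}"
        if "u < n" "u \<le> v + d + t" "v + d \<le> u + t" for u
        using that False j(4) nd by (intro image_eqI[of _ _ "u - d"]) auto
      then show "nodes_within (path_graph n) t (v + d)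
         = (\<lambda>u. u + d) ` {u. u < n' \<and> u \<le> v + t \<and> v \<le> u + t}"
        using v(1) nd by (auto simp: nodes_within_path_graph)
    qed (simp add: nodes_within_path_graph v(1))
    have "view_of t H (window_ident n w j) (prover H (window_ident n w j)) (v + d)
        = view_of t H' g cert v"
    proof (rule view_of_eqI[where f = "\<lambda>u. u + d"])
      show "inj_on g (nodes_within (fst H') t v)"
        "inj_on (window_ident n w j) (nodes_within (fst H) t (v + d))"
        by (simp_all add: H_def H'_def inj_ball)
    next
      fix a assume "a \<in> nodes_within (fst H') t v"
      then have a: "a < n'" "a \<ge> i" "a > 0" "a + d < n"
        using False bound nd by (auto simp: H'_def S)
      have "prover H (window_ident n w j) (a + d) = cert a"
      \<comment> \<open>Inside the window the glued certificates come from position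
        \<open>i\<close>; only here is the agreement with position \<open>j\<close> called
        upon.\<close>
      proof (cases "a < i + w")
        case True
        then show ?thesis
          using same[of "a - i"] a j(1) by (simp add: cert_def glue_def H_def n_def ac_simps)
      qed (use a in \<open>simp add: cert_def glue_def\<close>)
      moreover have "window_ident n w j (a + d) = g a"
        using a j(1) by (auto simp: g_def glue_def window_ident_def)
      \<comment> \<open>Evenness of \<open>d\<close> preserves the initial values, and
        \<open>a > 0\<close> rules out the exceptional node 0.\<close>
      moreover have "snd H (a + d) = snd H' a"
        using a j(2) nd by (auto simp: H_def H'_def snd_wave_instance)
      ultimately show "window_ident n w j (a + d) = g a \<and> snd H (a + d) = snd H' a \<and>
          prover H (window_ident n w j) (a + d) = cert a"
        by simp
    qed (use v(1) less in \<open>auto simp: H_def H'_def S bij_betw_def\<close>)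
    with accept[of "v + d" j] v less show False
      by simp
  qed
qed

section \<open>Counting\<close>

lemma finite_bool_lists_le: "finite {bs :: bool list. length bs \<le> l}"
  using finite_lists_length_le[of "UNIV :: bool set" l] by simp

lemma card_bool_lists_le: "card {bs :: bool list. length bs \<le> l} \<le> 2 ^ Suc l"
proof -
  have "card {bs :: bool list. length bs \<le> l} = (\<Sum>i\<le>l. 2 ^ i)"
    using card_lists_length_le[of "UNIV :: bool set" l] by (simp add: card_UNIV_bool)
  also have "\<dots> < 2 ^ Suc l"
    by (induction l) auto
  finally show ?thesis by simp
qed

text \<open>Pigeonhole: there are fewer than \<open>2 ^ Suc l\<close> words of length at most
  \<open>l\<close>, hence at most \<open>(2 ^ Suc l) ^ w\<close> tuples of \<open>w\<close>
  words.\<close>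

lemma repeated_word_tuple:
  fixes f :: "nat \<Rightarrow> nat \<Rightarrow> bool list"
  assumes "\<And>r q. r < R \<Longrightarrow> q < w \<Longrightarrow> length (f r q) \<le> l" and "(2 ^ Suc l) ^ w < R"
  shows "\<exists>r s. r < s \<and> s < R \<and> (\<forall>q<w. f r q = f s q)"
proof -
  define A where "A = {bs :: bool list. length bs \<le> l}"
  define h where "h r = map (f r) [0..<w]" for r
  have "finite {xs. set xs \<subseteq> A \<and> length xs = w}"
    by (rule finite_lists_length_eq) (simp add: A_def finite_bool_lists_le)
  moreover have "h ` {..<R} \<subseteq> {xs. set xs \<subseteq> A \<and> length xs = w}"
    using assms(1) by (auto simp: h_def A_def)
  ultimately have "card (h ` {..<R}) \<le> card {xs. set xs \<subseteq> A \<and> length xs = w}"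
    by (rule card_mono)
  also have "\<dots> = card A ^ w"
    by (rule card_lists_length_eq) (simp add: A_def finite_bool_lists_le)
  also have "\<dots> \<le> (2 ^ Suc l) ^ w"
    unfolding A_def by (rule power_mono[OF card_bool_lists_le]) simp
  also have "\<dots> < card {..<R}"
    using assms(2) by simp
  finally have "\<not> inj_on h {..<R}"
    by (rule pigeonhole)
  then obtain r s where "r < R" "s < R" "r \<noteq> s" "h r = h s"
    by (auto simp: inj_on_def)
  then obtain r s where "r < s" "s < R" "h r = h s"
    by (metis linorder_neqE_nat)
  then show ?thesis
    unfolding h_def by (intro exI[of _ r] exI[of _ s]) auto
qed

lemma certificate_length_le_size:
  assumes "H \<in> L" "fst H \<in> C" "ident \<in> identifier_assignments c (fst H)" "v \<in> pverts (fst H)"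
  shows "ereal (real (length (prover H ident v)))
    \<le> ereal_of_enat (certificate_size c L C prover (card (pverts (fst H))))"
proof -
  have "enat (length (prover H ident v)) \<le> certificate_size c L C prover (card (pverts (fst H)))"
    unfolding certificate_size_def by (rule SUP_upper2[where i = "(H, ident, v)"]) (use assms in auto)
  then have "ereal_of_enat (enat (length (prover H ident v)))
      \<le> ereal_of_enat (certificate_size c L C prover (card (pverts (fst H))))"
    by (simp only: ereal_of_enat_le_iff)
  then show ?thesis by simp
qed

section \<open>The lower bound: choice of constants and window positions\<close>

theorem theorem5:
  fixes c :: real
    and t :: nat
    and prover :: "(nat, nat \<times> nat \<times> nat) prover"
    and verifier :: "(nat \<times> nat \<times> nat) verifier"
  assumes "c > 1"
    and "locally_checkable_proof c reachability_instances reachability (max_degree_le 2)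
           t prover verifier"
  shows "\<exists>b > 0. \<forall>\<^sub>F n in sequentially.
           ereal (b * log 2 (real n))
             \<le> ereal_of_enat (certificate_size c reachability (max_degree_le 2) prover n)"
proof -
  define w where "w = 2 * t"
  \<comment> \<open>Chosen so that \<open>b * w = 1 / 2\<close>: the number of certificate tuples on
    a window is then of order \<open>sqrt n\<close>, below the linear number of positions.\<close>
  define b where "b = 1 / (2 * real w)"
  have t: "t \<ge> 1"
    using assms(2) by (simp add: locally_checkable_proof_def)
  have "b > 0"
    using t by (simp add: b_def w_def)
  have "\<forall>\<^sub>F n in sequentially. (2 ^ w) * real n powr (1 / 2) < real n / 8 - 1"
  proof -
    \<comment> \<open>Abstracting \<open>2 ^ w\<close> to a positive constant leaves a pure growth
      comparison in \<open>n\<close>.\<close>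
    have "\<forall>\<^sub>F n in sequentially. C * real n powr (1 / 2) < real n / 8 - 1" if "C > 0" for C :: real
      using that by real_asymp
    then show ?thesis by simp
  qed
  \<comment> \<open>The glued path keeps at least half of the nodes, and \<open>c > 1\<close> leaves
    room on it for identifiers up to \<open>w + 2 * n\<close>.\<close>
  moreover have "\<forall>\<^sub>F n in sequentially. real w + 2 * real n \<le> (real n / 2) powr c"
    using \<open>c > 1\<close> by real_asymp
  moreover have "\<forall>\<^sub>F n in sequentially. n \<ge> 4 * w + 8"
    by (rule eventually_ge_at_top)
  ultimately have "\<forall>\<^sub>F n in sequentially. ereal (b * log 2 (real n))
             \<le> ereal_of_enat (certificate_size c reachability (max_degree_le 2) prover n)"
  proof eventually_elim
    case (elim n)
    show ?case
    proof (rule ccontr)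
      assume small: "\<not> ?thesis"
      define m where "m = n - 3"
      define H where "H = wave_instance n m"
      define R where "R = n div 8"
      define l where "l = nat \<lfloor>b * log 2 (real n)\<rfloor>"
      \<comment> \<open>Steps of 2 make all differences even. With fewer than \<open>n / 8\<close>
        positions, at most a quarter of the path is ever cut out, and every window stays clear of
        both ends.\<close>
      define pos where "pos r = w + 1 + 2 * r" for r
      have n: "n = m + 3" "m > 0"
        using elim(3) by (auto simp: m_def)
      have ids: "real (w + 2 * n) \<le> real k powr c" if "n \<le> 2 * k" for k
      proof -
        have "(real n / 2) powr c \<le> real k powr c"
          using that \<open>c > 1\<close> by (intro powr_mono2) auto
        with elim(2) show ?thesis by simp
      qed
      have len: "length (prover H (window_ident n w i) v) \<le> l" if "v < n" for i v
      proof -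
        have "H \<in> reachability" "fst H \<in> max_degree_le 2"
          using wave_instance_reachable[OF n(2)] path_graph_max_degree[of n]
          by (auto simp: H_def n(1))
        moreover have "window_ident n w i \<in> identifier_assignments c (fst H)"
          using window_ident_assignment[OF ids[of n]] by (simp add: H_def)
        ultimately have "ereal (real (length (prover H (window_ident n w i) v)))
            \<le> ereal_of_enat (certificate_size c reachability (max_degree_le 2) prover n)"
          using certificate_length_le_size[of H reachability "max_degree_le 2" "window_ident n w i" c v prover]
            that by (simp add: H_def)
        also have "\<dots> < ereal (b * log 2 (real n))"
          using small by simp
        finally show ?thesis
          unfolding l_def by (intro le_nat_floor) simp
      qed
      have "real ((2 ^ Suc l) ^ w) < real R"
      proof -
        have "2 ^ l = 2 powr real l"
          by (simp add: powr_realpow)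
        also have "\<dots> \<le> 2 powr (b * log 2 (real n))"
          using \<open>b > 0\<close> elim(3) by (intro powr_mono) (auto simp: l_def)
        also have "\<dots> = real n powr b"
          using elim(3) powr_powr[of 2 "log 2 (real n)" b] by (simp add: mult.commute)
        finally have "(2 ^ l) ^ w \<le> (real n powr b) ^ w"
          by (rule power_mono) simp
        \<comment> \<open>This is where \<open>b * w = 1 / 2\<close> enters;
          \<open>t \<ge> 1\<close> ensures \<open>w > 0\<close>.\<close>
        also have "\<dots> = real n powr (1 / 2)"
          using elim(3) t by (simp add: powr_realpow[symmetric] powr_powr b_def w_def)
        finally have "real ((2 ^ Suc l) ^ w) \<le> 2 ^ w * real n powr (1 / 2)"
          by (simp add: power_mult_distrib)
        also have "\<dots> < real n / 8 - 1"
          by (rule elim(1))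
        also have "\<dots> \<le> real R"
          unfolding R_def by linarith
        finally show ?thesis .
      qed
      then have many: "(2 ^ Suc l) ^ w < R"
        by (simp only: of_nat_less_iff)
      have fits: "pos r + 2 * w < n" if "r < R" for r
        using that elim(3) by (simp add: pos_def R_def)
      have len': "length (prover H (window_ident n w (pos r)) (pos r + q)) \<le> l"
        if "r < R" "q < w" for r q
        using fits[OF that(1)] that(2) by (intro len) simp
      obtain r s where rs: "r < s" "s < R"
        and same: "\<forall>q<w. prover H (window_ident n w (pos r)) (pos r + q)
          = prover H (window_ident n w (pos s)) (pos s + q)"
        using repeated_word_tuple[of R w "\<lambda>r q. prover H (window_ident n w (pos r)) (pos r + q)" l, OF len' many]
        by blast
      show False
      proof (rule repeated_window_certs_contradiction[OF assms(2) w_def])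
        show "pos s = pos r + 2 * (s - r)" "even (2 * (s - r))" "2 * (s - r) > 0" "pos r > 0"
          using rs by (auto simp: pos_def)
        show "pos s + w < m + 3"
          using fits[OF rs(2)] n by simp
        show "real (w + 2 * (m + 3)) \<le> real (m + 3 - 2 * (s - r)) powr c"
          using ids[of "n - 2 * (s - r)"] rs by (simp add: n(1) R_def)
        show "c > 0"
          using \<open>c > 1\<close> by simp
      qed (use same in \<open>simp add: H_def n(1)\<close>)
    qed
  qed
  with \<open>b > 0\<close> show ?thesis by blast
qed

end
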